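(* Let $m\ge 1$ be an integer, let $\Sigma=\{\sigma_{ij}\}$ be an $m\times m$ (symmetric) positive semidefinite matrix with $\sigma_{jj}>0$ for all $j=1,\ldots,m$, and let $X=(X_1,\ldots,X_m)\sim \mathrm{N}(0,\Sigma)$. Let $(w_1,\ldots,w_m)$ be a random vector that is independent of $X$ and satisfies $w_j\ge 0$ for $j=1,\ldots,m$ and $\sum_{j=1}^m w_j=1$. Then $$\left(\frac{w_1}{X_1},\ldots,\frac{w_m}{X_m}\right)\Sigma\left(\frac{w_1}{X_1},\ldots,\frac{w_m}{X_m}\right)^{\top}\ \sim\ \chi^{-2}_1 .$$
   Context: $\mathrm{N}(0,\Sigma)$ denotes the (possibly degenerate) centered multivariate Gaussian distribution on $\mathbb{R}^m$ with covariance matrix $\Sigma$; $\Sigma$ may be singular. $\chi^{-2}_1$ denotes an inverse chi-squared variable with $1$ degree of freedom, i.e. the distribution of $1/V$ where $V\sim\chi^2_1$ (equivalently, the standard Lévy distribution with location $0$ and scale $1$). Since $\sigma_{jj}>0$, each $X_j$ is nonzero almost surely, so the left-hand side, which equals $\sum_{i=1}^m\sum_{j=1}^m \frac{w_i w_j\sigma_{ij}}{X_iX_j}$, is defined almost surely. The weights may in particular be deterministic constants. *)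

theory Defs
  imports "HOL-Probability.Probability"
begin

definition psd_matrix :: "real^'n^'n \<Rightarrow> bool" where
  "psd_matrix S \<longleftrightarrow> transpose S = S \<and> (\<forall>x. 0 \<le> x \<bullet> (S *v x))"

abbreviation std_normal :: "real measure" where
  "std_normal \<equiv> density lborel (\<lambda>x. ennreal (std_normal_density x))"

text \<open>
  The centered, possibly degenerate, Gaussian law with covariance matrix \<open>S\<close>: the law of
  \<open>A Z\<close> with \<open>Z\<close> a vector of independent standard normal variables and \<open>A A\<^sup>T = S\<close>.
  A density is not available as a definition since \<open>S\<close> may be singular. The law does not depend
  on the choice of \<open>A\<close>. A square \<open>A\<close> exists for every positive semidefinite \<open>S\<close>.
\<close>
definition centered_gaussian :: "real^'n^'n \<Rightarrow> (real^'n) measure \<Rightarrow> bool" where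
  "centered_gaussian S N \<longleftrightarrow>
     (\<exists>A :: real^'n^'n. A ** transpose A = S \<and>
        N = distr (\<Pi>\<^sub>M j\<in>UNIV. std_normal) borel (\<lambda>z. A *v (\<chi> j. z j)))"

definition chi_squared :: "nat \<Rightarrow> real measure" where
  "chi_squared k = distr (\<Pi>\<^sub>M i\<in>{..<k}. std_normal) borel (\<lambda>z. \<Sum>i<k. (z i)\<^sup>2)"

definition inverse_chi_squared :: "nat \<Rightarrow> real measure" where
  "inverse_chi_squared k = distr (chi_squared k) borel inverse"

text \<open>Consistency checks: the maps above are measurable, and \<open>S\<close> is indeed the covariance
  matrix of the law described by \<^const>\<open>centered_gaussian\<close>, whose mean is zero.\<close>

lemma measurable_vec_lambda_PiM [measurable]:
  "(\<lambda>z. A *v (\<chi> j. z j)) \<in> (\<Pi>\<^sub>M j\<in>UNIV. std_normal) \<rightarrow>\<^sub>M (borel :: (real^'n) measure)"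
  for A :: "real^'n^'n"
proof -
  have [measurable]: "(\<lambda>z. z j) \<in> borel_measurable (\<Pi>\<^sub>M j\<in>UNIV. std_normal)" for j :: 'n
    using measurable_component_singleton[of j UNIV "\<lambda>_. std_normal"] by simp
  show ?thesis
    by (rule borel_measurable_euclidean_space[THEN iffD2])
      (auto simp: Basis_vec_def inner_axis matrix_vector_mult_def)
qed

lemma prob_space_chi_squared: "prob_space (chi_squared k)"
  unfolding chi_squared_def
proof (rule prob_space.prob_space_distr)
  show "prob_space (\<Pi>\<^sub>M i\<in>{..<k}. std_normal)"
    by (intro prob_space_PiM prob_space_normal_density) auto
  have [measurable]: "(\<lambda>z. z i) \<in> borel_measurable (\<Pi>\<^sub>M i\<in>{..<k}. std_normal)" if "i < k" for i
    using measurable_component_singleton[of i "{..<k}" "\<lambda>_. std_normal"] that by simp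
  show "(\<lambda>z. \<Sum>i<k. (z i)\<^sup>2) \<in> (\<Pi>\<^sub>M i\<in>{..<k}. std_normal) \<rightarrow>\<^sub>M borel"
    by measurable
qed

lemma centered_gaussian_moments:
  fixes S :: "real^'n^'n"
  assumes "centered_gaussian S N"
  shows "prob_space N" "sets N = sets borel"
    and "(\<integral>x. x $ i \<partial>N) = 0"
    and "(\<integral>x. x $ i * x $ j \<partial>N) = S $ i $ j"
proof -
  obtain A :: "real^'n^'n" where A: "A ** transpose A = S"
    and N: "N = distr (\<Pi>\<^sub>M j\<in>UNIV. std_normal) borel (\<lambda>z. A *v (\<chi> j. z j))"
    using assms unfolding centered_gaussian_def by blast
  let ?P = "\<Pi>\<^sub>M j\<in>(UNIV::'n set). std_normal"
  interpret std: prob_space std_normal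
    by (rule prob_space_normal_density) simp
  interpret product_sigma_finite "\<lambda>_::'n. std_normal"
    by unfold_locales
  have P: "prob_space ?P"
    by (intro prob_space_PiM std.prob_space_axioms)
  show "prob_space N" "sets N = sets borel"
    unfolding N by (auto intro: prob_space.prob_space_distr P)
  have m: "integrable std_normal (\<lambda>x. x ^ k)" for k
    by (subst integrable_density) (use integrable_std_normal_moment[of k] in auto)
  have m0: "(\<integral>x. x \<partial>std_normal) = 0"
    using integral_std_normal_moment_odd[of 0] by (subst integral_density) auto
  have m1: "(\<integral>x. x ^ 2 \<partial>std_normal) = 1"
    using integral_std_normal_moment_even[of 1] by (subst integral_density) auto
  define e where "e a b k = (\<lambda>x::real. x ^ ((if k = a then 1 else 0) + (if k = b then 1 else 0)))"
    for a b k :: 'n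
  have e: "(\<lambda>z. \<Prod>k\<in>UNIV. e a b k (z k)) = (\<lambda>z. z a * z b)" for a b
    by (rule ext) (simp add: e_def power_add prod.distrib if_distrib[where f="\<lambda>n. _ ^ n"] cong: if_cong)
  have ei: "integrable std_normal (e a b k)" for a b k
    unfolding e_def by (rule m)
  have int2: "integrable ?P (\<lambda>z. z a * z b)" for a b
    using product_integrable_prod[OF finite_class.finite_UNIV, of "e a b"] ei by (simp add: e)
  have I2: "(\<integral>z. z a * z b \<partial>?P) = (if a = b then 1 else 0)" for a b
  proof -
    have "(\<integral>z. z a * z b \<partial>?P) = (\<Prod>k\<in>UNIV. integral\<^sup>L std_normal (e a b k))"
      using product_integral_prod[OF finite_class.finite_UNIV, of "e a b"] ei by (simp add: e)
    also have "\<dots> = (if a = b then 1 else 0)"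
    proof (cases "a = b")
      case True
      have "integral\<^sup>L std_normal (e a b k) = 1" for k
        using True m1 std.prob_space by (cases "k = a") (simp_all add: e_def power2_eq_square)
      then show ?thesis using True by simp
    next
      case False
      have "integral\<^sup>L std_normal (e a b a) = 0"
        using False m0 by (simp add: e_def)
      then show ?thesis using False by (auto intro!: prod_zero)
    qed
    finally show ?thesis .
  qed
  define d where "d a k = (\<lambda>x::real. x ^ (if k = a then 1 else 0))" for a k :: 'n
  have d: "(\<lambda>z. \<Prod>k\<in>UNIV. d a k (z k)) = (\<lambda>z. z a)" for a
    by (rule ext) (simp add: d_def if_distrib[where f="\<lambda>n. _ ^ n"] cong: if_cong)
  have di: "integrable std_normal (d a k)" for a k
    unfolding d_def by (rule m)
  have int1: "integrable ?P (\<lambda>z. z a)" for a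
    using product_integrable_prod[OF finite_class.finite_UNIV, of "d a"] di by (simp add: d)
  have I1: "(\<integral>z. z a \<partial>?P) = 0" for a
  proof -
    have "(\<integral>z. z a \<partial>?P) = (\<Prod>k\<in>UNIV. integral\<^sup>L std_normal (d a k))"
      using product_integral_prod[OF finite_class.finite_UNIV, of "d a"] di by (simp add: d)
    moreover have "integral\<^sup>L std_normal (d a a) = 0"
      using m0 by (simp add: d_def)
    ultimately show ?thesis by (metis UNIV_I finite_class.finite_UNIV prod_zero)
  qed
  have "(\<integral>x. x $ i \<partial>N) = (\<integral>z. (A *v (\<chi> j. z j)) $ i \<partial>?P)"
    unfolding N by (subst integral_distr) auto
  also have "\<dots> = 0"
    by (simp add: matrix_vector_mult_def int1 I1)
  finally show "(\<integral>x. x $ i \<partial>N) = 0" .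
  have "(\<integral>x. x $ i * x $ j \<partial>N) = (\<integral>z. (A *v (\<chi> j. z j)) $ i * (A *v (\<chi> j. z j)) $ j \<partial>?P)"
    unfolding N by (subst integral_distr) auto
  also have "\<dots> = (\<integral>z. (\<Sum>a\<in>UNIV. \<Sum>b\<in>UNIV. A $ i $ a * A $ j $ b * (z a * z b)) \<partial>?P)"
    by (simp add: matrix_vector_mult_def sum_product mult_ac)
  also have "\<dots> = (\<Sum>a\<in>UNIV. \<Sum>b\<in>UNIV. A $ i $ a * A $ j $ b * (if a = b then 1 else 0))"
    by (subst Bochner_Integration.integral_sum, simp add: int2)
       (subst Bochner_Integration.integral_sum, simp_all add: int2 I2)
  also have "\<dots> = S $ i $ j"
    by (simp add: A[symmetric] matrix_matrix_mult_def transpose_def if_distrib cong: if_cong)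
  finally show "(\<integral>x. x $ i * x $ j \<partial>N) = S $ i $ j" .
qed

end

theory Submission
  imports Defs "HOL-Complex_Analysis.Cauchy_Integral_Formula"
begin

text \<open>
  Write \<open>X = A Z\<close> with \<open>A A\<^sup>T = S\<close> and \<open>Z\<close> standard Gaussian, and call the quadratic form \<open>Q\<close>. The law of
  \<open>Q\<close> is found from its Laplace transform, which is \<open>exp (- sqrt (2 * s))\<close> for every \<open>m\<close>, every
  admissible \<open>S\<close> and all weights. No density and no special integral is computed: \<open>\<chi>\<^sup>-\<^sup>2\<close> with one
  degree of freedom is the law of \<open>1 / Z\<^sup>2\<close>, the case \<open>m = 1\<close>, so it has the same transform.

  Fix the weights first. They are independent of \<open>X\<close>, and the transform found below
  does not depend on them, so randomness of the weights is harmless.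
  Let \<open>Z'\<close> be an independent copy of \<open>Z\<close> and \<open>Y = A Z'\<close>. Given \<open>X\<close>, the sum
  \<open>T = \<Sum>j. w j * Y j / X j\<close> is a centered Gaussian with variance \<open>Q\<close>, so
  \<open>E (exp (i t T)) = E (exp (- t\<^sup>2 Q / 2))\<close>. It remains to see that \<open>T\<close> has the Cauchy characteristic
  function \<open>exp (- t)\<close> for \<open>t \<ge> 0\<close>. The pair \<open>(Z, Z')\<close> is invariant under the rotations
  \<open>(z, z') \<mapsto> (cos \<theta> z - sin \<theta> z', sin \<theta> z + cos \<theta> z')\<close>
  (\<open>gauss_rotation_invariant\<close>), and such a rotation turns all points \<open>X j + i Y j\<close> of the plane by the
  same angle \<open>\<theta>\<close>. Hence \<open>T\<close> may be replaced by \<open>\<Sum>j. w j * tan (\<alpha> j + \<theta>)\<close> with fixed angles \<open>\<alpha> j\<close> and \<open>\<theta>\<close>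
  uniform on \<open>(0, \<pi>)\<close>. In the variable \<open>\<zeta> = exp (2 i \<theta>)\<close>, the function \<open>exp (i t T)\<close> is the boundary
  value of a bounded holomorphic function on the unit disc, whose value at \<open>0\<close> is
  \<open>exp (- t * \<Sum>j. w j) = exp (- t)\<close>. By the mean value property this is the average over \<open>\<theta>\<close>
  (\<open>circle_mean_exp_cayley\<close>). This gives \<open>integral_gauss_exp_inverse_form\<close>.

  Finally a law on \<open>[0, \<infinity>)\<close> is determined by its Laplace transform at the natural numbers
  (\<open>distr_eqI_laplace\<close>), because these values are the moments of the bounded variable \<open>exp (- x)\<close>.
\<close>

section \<open>Rotation invariance of a pair of independent Gaussian vectors\<close>

abbreviation lebesgue_prod :: "'k set \<Rightarrow> ('k \<Rightarrow> real) measure" where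
  "lebesgue_prod K \<equiv> \<Pi>\<^sub>M k\<in>K. lborel"

abbreviation gauss :: "'k set \<Rightarrow> ('k \<Rightarrow> real) measure" where
  "gauss K \<equiv> \<Pi>\<^sub>M k\<in>K. std_normal"

interpretation std: prob_space std_normal
  by (rule prob_space_normal_density) simp

interpretation prod_std: product_sigma_finite "\<lambda>_::'k. std_normal"
  by unfold_locales

interpretation prod_lborel: product_sigma_finite "\<lambda>_::'k. lborel :: real measure"
  by unfold_locales

lemma prob_space_gauss: "prob_space (gauss K)"
  by (intro prob_space_PiM std.prob_space_axioms)

lemma sigma_finite_lebesgue_prod:
  assumes "finite K" shows "sigma_finite_measure (lebesgue_prod K)"
  using prod_lborel.sigma_finite[OF assms] .

lemma sets_gauss: "sets (gauss K) = sets (lebesgue_prod K)"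
  by (intro sets_PiM_cong) auto

lemma gauss_eq_density:
  assumes K: "finite K"
  shows "gauss K = density (lebesgue_prod K) (\<lambda>z. \<Prod>k\<in>K. ennreal (std_normal_density (z k)))"
proof (rule prod_std.PiM_eqI[OF K, symmetric])
  show "sets (density (lebesgue_prod K) (\<lambda>z. \<Prod>k\<in>K. ennreal (std_normal_density (z k)))) = sets (gauss K)"
    by (simp add: sets_gauss)
next
  fix A assume A: "\<And>i. i \<in> K \<Longrightarrow> A i \<in> sets std_normal"
  then have [measurable]: "\<And>i. i \<in> K \<Longrightarrow> A i \<in> sets borel" by simp
  have box: "Pi\<^sub>E K A \<in> sets (lebesgue_prod K)"
    using A K by (intro sets_PiM_I_finite) auto
  have "emeasure (density (lebesgue_prod K) (\<lambda>z. \<Prod>k\<in>K. ennreal (std_normal_density (z k)))) (Pi\<^sub>E K A)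
      = (\<integral>\<^sup>+z. (\<Prod>k\<in>K. ennreal (std_normal_density (z k))) * indicator (Pi\<^sub>E K A) z \<partial>lebesgue_prod K)"
    by (rule emeasure_density) (use box in auto)
  also have "\<dots> = (\<integral>\<^sup>+z. (\<Prod>k\<in>K. ennreal (std_normal_density (z k)) * indicator (A k) (z k)) \<partial>lebesgue_prod K)"
  proof (intro nn_integral_cong)
    fix z :: "'a \<Rightarrow> real" assume "z \<in> space (lebesgue_prod K)"
    then have "indicator (Pi\<^sub>E K A) z = (\<Prod>k\<in>K. indicator (A k) (z k) :: ennreal)"
      using K by (auto simp: space_PiM PiE_iff indicator_def prod_zero_iff)
    then show "(\<Prod>k\<in>K. ennreal (std_normal_density (z k))) * indicator (Pi\<^sub>E K A) z
        = (\<Prod>k\<in>K. ennreal (std_normal_density (z k)) * indicator (A k) (z k))"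
      by (simp add: prod.distrib)
  qed
  also have "\<dots> = (\<Prod>k\<in>K. \<integral>\<^sup>+x. ennreal (std_normal_density x) * indicator (A k) x \<partial>lborel)"
    by (rule prod_lborel.product_nn_integral_prod[OF K]) measurable
  also have "\<dots> = (\<Prod>k\<in>K. emeasure std_normal (A k))"
    by (intro prod.cong refl emeasure_density[symmetric]) auto
  finally show "emeasure (density (lebesgue_prod K) (\<lambda>z. \<Prod>k\<in>K. ennreal (std_normal_density (z k)))) (Pi\<^sub>E K A)
      = (\<Prod>k\<in>K. emeasure std_normal (A k))" .
qed

text \<open>
  Translating a box coordinatewise does not change its volume. This is all the geometry of Lebesgue
  measure that is used; the rotation below is assembled from it.
\<close>

lemma lebesgue_prod_translation:
  assumes K: "finite K"
  shows "distr (lebesgue_prod K) (lebesgue_prod K) (\<lambda>x. \<lambda>k\<in>K. x k + c k) = lebesgue_prod K"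
proof (rule prod_lborel.PiM_eqI[OF K])
  fix A assume A: "\<And>i. i \<in> K \<Longrightarrow> A i \<in> sets (lborel :: real measure)"
  then have [measurable]: "\<And>i. i \<in> K \<Longrightarrow> A i \<in> sets borel" by simp
  have box: "Pi\<^sub>E K A \<in> sets (lebesgue_prod K)"
    using A K by (intro sets_PiM_I_finite) auto
  have "emeasure (distr (lebesgue_prod K) (lebesgue_prod K) (\<lambda>x. \<lambda>k\<in>K. x k + c k)) (Pi\<^sub>E K A)
      = emeasure (lebesgue_prod K) ((\<lambda>x. \<lambda>k\<in>K. x k + c k) -` Pi\<^sub>E K A \<inter> space (lebesgue_prod K))"
    by (rule emeasure_distr) (use box in measurable)
  also have "(\<lambda>x. \<lambda>k\<in>K. x k + c k) -` Pi\<^sub>E K A \<inter> space (lebesgue_prod K)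
      = Pi\<^sub>E K (\<lambda>k. (+) (c k) -` A k)"
    by (auto simp: space_PiM PiE_iff add.commute)
  also have "emeasure (lebesgue_prod K) \<dots> = (\<Prod>k\<in>K. emeasure lborel ((+) (c k) -` A k))"
  proof (rule prod_lborel.emeasure_PiM[OF K])
    fix k assume "k \<in> K"
    then have "(+) (c k) -` A k \<in> sets borel"
      using A by (intro measurable_sets_borel[of _ borel]) auto
    then show "(+) (c k) -` A k \<in> sets lborel" by simp
  qed
  also have "\<dots> = (\<Prod>k\<in>K. emeasure lborel (A k))"
  proof (intro prod.cong refl)
    fix k assume "k \<in> K"
    then have "emeasure lborel (A k) = emeasure (distr lborel borel ((+) (c k))) (A k)"
      by (simp add: lborel_distr_plus)
    also have "\<dots> = emeasure lborel ((+) (c k) -` A k)"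
      using A[OF \<open>k \<in> K\<close>] by (subst emeasure_distr) auto
    finally show "emeasure lborel ((+) (c k) -` A k) = emeasure lborel (A k)" ..
  qed
  finally show "emeasure (distr (lebesgue_prod K) (lebesgue_prod K) (\<lambda>x. \<lambda>k\<in>K. x k + c k)) (Pi\<^sub>E K A)
      = (\<Prod>k\<in>K. emeasure lborel (A k))" .
qed simp

definition shear_fst :: "'k set \<Rightarrow> real \<Rightarrow> ('k \<Rightarrow> real) \<times> ('k \<Rightarrow> real) \<Rightarrow> ('k \<Rightarrow> real) \<times> ('k \<Rightarrow> real)" where
  "shear_fst K a = (\<lambda>p. (\<lambda>k\<in>K. fst p k + a * snd p k, snd p))"

definition shear_snd :: "'k set \<Rightarrow> real \<Rightarrow> ('k \<Rightarrow> real) \<times> ('k \<Rightarrow> real) \<Rightarrow> ('k \<Rightarrow> real) \<times> ('k \<Rightarrow> real)" where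
  "shear_snd K a = (\<lambda>p. (fst p, \<lambda>k\<in>K. snd p k + a * fst p k))"

lemma measurable_shear [measurable]:
  "shear_fst K a \<in> lebesgue_prod K \<Otimes>\<^sub>M lebesgue_prod K \<rightarrow>\<^sub>M lebesgue_prod K \<Otimes>\<^sub>M lebesgue_prod K"
  "shear_snd K a \<in> lebesgue_prod K \<Otimes>\<^sub>M lebesgue_prod K \<rightarrow>\<^sub>M lebesgue_prod K \<Otimes>\<^sub>M lebesgue_prod K"
  unfolding shear_fst_def shear_snd_def by measurable

text \<open>
  With one component of the pair held fixed, a shear translates the other one, so invariance follows
  from Fubini's theorem.
\<close>

lemma nn_integral_shear:
  assumes K: "finite K" and g[measurable]: "g \<in> borel_measurable (lebesgue_prod K \<Otimes>\<^sub>M lebesgue_prod K)"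
  shows "(\<integral>\<^sup>+p. g (shear_fst K a p) \<partial>(lebesgue_prod K \<Otimes>\<^sub>M lebesgue_prod K)) = (\<integral>\<^sup>+p. g p \<partial>(lebesgue_prod K \<Otimes>\<^sub>M lebesgue_prod K))"
    and "(\<integral>\<^sup>+p. g (shear_snd K a p) \<partial>(lebesgue_prod K \<Otimes>\<^sub>M lebesgue_prod K)) = (\<integral>\<^sup>+p. g p \<partial>(lebesgue_prod K \<Otimes>\<^sub>M lebesgue_prod K))"
proof -
  let ?L = "lebesgue_prod K"
  interpret L: sigma_finite_measure ?L by (rule sigma_finite_lebesgue_prod[OF K])
  interpret LL: pair_sigma_finite ?L ?L ..
  have tr: "(\<integral>\<^sup>+x. f (\<lambda>k\<in>K. x k + c k) \<partial>?L) = (\<integral>\<^sup>+x. f x \<partial>?L)"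
    if [measurable]: "f \<in> borel_measurable ?L" for f :: "('a \<Rightarrow> real) \<Rightarrow> ennreal" and c
  proof -
    have "(\<integral>\<^sup>+x. f x \<partial>?L) = (\<integral>\<^sup>+x. f x \<partial>distr ?L ?L (\<lambda>x. \<lambda>k\<in>K. x k + c k))"
      by (simp only: lebesgue_prod_translation[OF K])
    also have "\<dots> = (\<integral>\<^sup>+x. f (\<lambda>k\<in>K. x k + c k) \<partial>?L)"
      by (rule nn_integral_distr) measurable
    finally show ?thesis ..
  qed
  have "(\<integral>\<^sup>+p. g (shear_fst K a p) \<partial>(?L \<Otimes>\<^sub>M ?L)) = (\<integral>\<^sup>+y. \<integral>\<^sup>+x. g (shear_fst K a (x, y)) \<partial>?L \<partial>?L)"
    by (rule LL.nn_integral_snd[symmetric, where f="\<lambda>p. g (shear_fst K a p)"]) measurable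
  also have "\<dots> = (\<integral>\<^sup>+y. \<integral>\<^sup>+x. g (x, y) \<partial>?L \<partial>?L)"
  proof (rule nn_integral_cong)
    fix y assume [measurable]: "y \<in> space ?L"
    show "(\<integral>\<^sup>+x. g (shear_fst K a (x, y)) \<partial>?L) = (\<integral>\<^sup>+x. g (x, y) \<partial>?L)"
      using tr[of "\<lambda>x. g (x, y)" "\<lambda>k. a * y k"] by (simp add: shear_fst_def)
  qed
  also have "\<dots> = (\<integral>\<^sup>+p. g p \<partial>(?L \<Otimes>\<^sub>M ?L))"
    by (rule LL.nn_integral_snd) measurable
  finally show "(\<integral>\<^sup>+p. g (shear_fst K a p) \<partial>(?L \<Otimes>\<^sub>M ?L)) = (\<integral>\<^sup>+p. g p \<partial>(?L \<Otimes>\<^sub>M ?L))" .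
  have "(\<integral>\<^sup>+p. g (shear_snd K a p) \<partial>(?L \<Otimes>\<^sub>M ?L)) = (\<integral>\<^sup>+x. \<integral>\<^sup>+y. g (shear_snd K a (x, y)) \<partial>?L \<partial>?L)"
    by (rule L.nn_integral_fst[symmetric, where f="\<lambda>p. g (shear_snd K a p)"]) measurable
  also have "\<dots> = (\<integral>\<^sup>+x. \<integral>\<^sup>+y. g (x, y) \<partial>?L \<partial>?L)"
  proof (rule nn_integral_cong)
    fix x assume [measurable]: "x \<in> space ?L"
    show "(\<integral>\<^sup>+y. g (shear_snd K a (x, y)) \<partial>?L) = (\<integral>\<^sup>+y. g (x, y) \<partial>?L)"
      using tr[of "\<lambda>y. g (x, y)" "\<lambda>k. a * x k"] by (simp add: shear_snd_def)
  qed
  also have "\<dots> = (\<integral>\<^sup>+p. g p \<partial>(?L \<Otimes>\<^sub>M ?L))"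
    by (rule L.nn_integral_fst) measurable
  finally show "(\<integral>\<^sup>+p. g (shear_snd K a p) \<partial>(?L \<Otimes>\<^sub>M ?L)) = (\<integral>\<^sup>+p. g p \<partial>(?L \<Otimes>\<^sub>M ?L))" .
qed

definition rotate_pair :: "'k set \<Rightarrow> real \<Rightarrow> ('k \<Rightarrow> real) \<times> ('k \<Rightarrow> real) \<Rightarrow> ('k \<Rightarrow> real) \<times> ('k \<Rightarrow> real)" where
  "rotate_pair K \<theta> = (\<lambda>p. (\<lambda>k\<in>K. cos \<theta> * fst p k - sin \<theta> * snd p k, \<lambda>k\<in>K. sin \<theta> * fst p k + cos \<theta> * snd p k))"

text \<open>
  A plane rotation is the product of three shears, with parameters \<open>- tan (\<theta>/2)\<close>, \<open>sin \<theta>\<close> and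
  \<open>- tan (\<theta>/2)\<close>. The half turn is excluded because there the tangent has a pole.
\<close>

lemma rotate_pair_eq_shears:
  assumes "cos \<theta> \<noteq> -1"
  defines "a \<equiv> - sin \<theta> / (1 + cos \<theta>)"
  shows "rotate_pair K \<theta> p = shear_fst K a (shear_snd K (sin \<theta>) (shear_fst K a p))"
proof -
  have a: "a * (1 + cos \<theta>) = - sin \<theta>" using assms(1) by (simp add: a_def add_eq_0_iff)
  have b: "1 + a * sin \<theta> = cos \<theta>"
  proof -
    have "(1 + cos \<theta>) * (1 + a * sin \<theta>) = (1 + cos \<theta>) - sin \<theta> * sin \<theta>"
      using a by algebra
    also have "\<dots> = (1 + cos \<theta>) * cos \<theta>"
      using sin_cos_squared_add3[of \<theta>] by (simp add: algebra_simps)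
    finally show ?thesis using assms(1) by (simp add: add_eq_0_iff)
  qed
  have 1: "sin \<theta> * x + cos \<theta> * y = y + sin \<theta> * (x + a * y)" for x y
    unfolding b[symmetric] by (simp add: algebra_simps)
  have 2: "cos \<theta> * x - sin \<theta> * y = (x + a * y) + a * (sin \<theta> * x + cos \<theta> * y)" for x y
  proof -
    have "(x + a * y) + a * (sin \<theta> * x + cos \<theta> * y) = (1 + a * sin \<theta>) * x + (a * (1 + cos \<theta>)) * y"
      by (simp add: algebra_simps)
    then show ?thesis unfolding a b by simp
  qed
  show ?thesis
    unfolding rotate_pair_def shear_fst_def shear_snd_def by (auto simp: 2 fun_eq_iff) (auto simp: 1 2)
qed

lemma measurable_rotate_pair [measurable]:
  "rotate_pair K \<theta> \<in> gauss K \<Otimes>\<^sub>M gauss K \<rightarrow>\<^sub>M gauss K \<Otimes>\<^sub>M gauss K"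
  unfolding rotate_pair_def by measurable

lemma std_normal_density_rotate:
  "std_normal_density (cos \<theta> * x - sin \<theta> * y) * std_normal_density (sin \<theta> * x + cos \<theta> * y)
   = std_normal_density x * std_normal_density y"
proof -
  have "(cos \<theta> * x - sin \<theta> * y)\<^sup>2 + (sin \<theta> * x + cos \<theta> * y)\<^sup>2 = x\<^sup>2 + y\<^sup>2"
    using sin_cos_squared_add[of \<theta>] by algebra
  then have "- (cos \<theta> * x - sin \<theta> * y)\<^sup>2 / 2 + - (sin \<theta> * x + cos \<theta> * y)\<^sup>2 / 2 = - x\<^sup>2 / 2 + - y\<^sup>2 / 2"
    by (simp add: field_simps)
  then show ?thesis
    unfolding std_normal_density_def by (simp add: exp_add[symmetric])
qed

text \<open>
  The joint density depends only on the sum of the squares of all coordinates, which the rotation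
  preserves, and the underlying Lebesgue measure is invariant because the rotation is a product of shears.
\<close>

lemma gauss_rotation_invariant:
  assumes K: "finite K" and c: "cos \<theta> \<noteq> -1"
  shows "distr (gauss K \<Otimes>\<^sub>M gauss K) (gauss K \<Otimes>\<^sub>M gauss K) (rotate_pair K \<theta>) = gauss K \<Otimes>\<^sub>M gauss K"
proof (rule measure_eqI)
  let ?L = "lebesgue_prod K" and ?G = "gauss K"
  let ?d = "\<lambda>z. \<Prod>k\<in>K. ennreal (std_normal_density (z k))"
  let ?D = "\<lambda>p. ?d (fst p) * ?d (snd p)"
  interpret G: prob_space ?G by (rule prob_space_gauss)
  have GG: "?G \<Otimes>\<^sub>M ?G = density (?L \<Otimes>\<^sub>M ?L) ?D"
    using pair_measure_density[of ?d ?L ?d ?L] sigma_finite_lebesgue_prod[OF K] G.sigma_finite_measure_axioms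
    by (simp add: gauss_eq_density[OF K] split_beta')
  have sets_GG: "sets (?G \<Otimes>\<^sub>M ?G) = sets (?L \<Otimes>\<^sub>M ?L)"
    by (intro sets_pair_measure_cong sets_gauss)
  have rot[measurable]: "rotate_pair K \<theta> \<in> ?L \<Otimes>\<^sub>M ?L \<rightarrow>\<^sub>M ?L \<Otimes>\<^sub>M ?L"
    unfolding rotate_pair_def by measurable
  have D: "?D (rotate_pair K \<theta> p) = ?D p" for p
    unfolding rotate_pair_def
    by (simp add: prod.distrib[symmetric] ennreal_mult[symmetric] std_normal_density_rotate)
  fix A assume "A \<in> sets (distr (?G \<Otimes>\<^sub>M ?G) (?G \<Otimes>\<^sub>M ?G) (rotate_pair K \<theta>))"
  then have A: "A \<in> sets (?G \<Otimes>\<^sub>M ?G)" by simp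
  then have A'[measurable]: "A \<in> sets (?L \<Otimes>\<^sub>M ?L)" by (simp add: sets_GG)
  define g where "g p = ?D p * indicator A p" for p
  have g[measurable]: "g \<in> borel_measurable (?L \<Otimes>\<^sub>M ?L)" unfolding g_def by measurable
  have "emeasure (distr (?G \<Otimes>\<^sub>M ?G) (?G \<Otimes>\<^sub>M ?G) (rotate_pair K \<theta>)) A
      = (\<integral>\<^sup>+p. indicator A p \<partial>distr (?G \<Otimes>\<^sub>M ?G) (?G \<Otimes>\<^sub>M ?G) (rotate_pair K \<theta>))"
    using A by simp
  also have "\<dots> = (\<integral>\<^sup>+p. indicator A (rotate_pair K \<theta> p) \<partial>(?G \<Otimes>\<^sub>M ?G))"
    by (rule nn_integral_distr) (use A in measurable)
  also have "\<dots> = (\<integral>\<^sup>+p. ?D p * indicator A (rotate_pair K \<theta> p) \<partial>(?L \<Otimes>\<^sub>M ?L))"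
    unfolding GG by (rule nn_integral_density) measurable
  also have "\<dots> = (\<integral>\<^sup>+p. g (rotate_pair K \<theta> p) \<partial>(?L \<Otimes>\<^sub>M ?L))"
    by (simp add: g_def D)
  also have "\<dots> = (\<integral>\<^sup>+p. g p \<partial>(?L \<Otimes>\<^sub>M ?L))"
    unfolding rotate_pair_eq_shears[OF c]
    by (subst nn_integral_shear[OF K, where g="\<lambda>q. g (shear_fst K _ (shear_snd K _ q))"], measurable)
       (subst nn_integral_shear[OF K, where g="\<lambda>q. g (shear_fst K _ q)"], measurable,
        rule nn_integral_shear[OF K g])
  also have "\<dots> = emeasure (?G \<Otimes>\<^sub>M ?G) A"
    unfolding GG g_def by (rule emeasure_density[symmetric]) measurable
  finally show "emeasure (distr (?G \<Otimes>\<^sub>M ?G) (?G \<Otimes>\<^sub>M ?G) (rotate_pair K \<theta>)) A = emeasure (?G \<Otimes>\<^sub>M ?G) A" .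
qed simp

section \<open>The mean value of a bounded holomorphic function on the disc\<close>

lemma circle_mean_value:
  assumes "f holomorphic_on cball 0 r" "0 < r"
  shows "((\<lambda>s. f (r * exp (2 * of_real pi * \<i> * of_real s))) has_integral f 0) {0..1::real}"
proof -
  have "((\<lambda>u. f u / (u - 0)) has_contour_integral (2 * of_real pi * \<i> * f 0)) (circlepath 0 r)"
    by (rule Cauchy_integral_circlepath_simple) (use assms in auto)
  then have "((\<lambda>x. f (circlepath 0 r x) / circlepath 0 r x * vector_derivative (circlepath 0 r) (at x within {0..1}))
      has_integral 2 * of_real pi * \<i> * f 0) {0..1}"
    by (simp add: has_contour_integral_def)
  then have "((\<lambda>x. (2 * of_real pi * \<i>) * f (r * exp (2 * of_real pi * \<i> * of_real x)))
      has_integral 2 * of_real pi * \<i> * f 0) {0..1}"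
    by (rule has_integral_eq[rotated])
       (use assms(2) in \<open>auto simp: vector_derivative_circlepath01 simp flip: circlepath, auto simp: circlepath\<close>)
  from has_integral_mult_right[OF this, of "1 / (2 * of_real pi * \<i>)"] show ?thesis
    by simp
qed

text \<open>
  The Cayley transform \<open>z \<mapsto> (1 - z) / (1 + z)\<close> maps the unit disc to the right half-plane. At the pole
  \<open>z = - 1\<close> the bound holds because division by zero gives zero.
\<close>

lemma cayley_Re_nonneg:
  assumes "norm (z::complex) \<le> 1"
  shows "0 \<le> Re ((1 - z) / (1 + z))"
proof -
  have "(Re z)\<^sup>2 + (Im z)\<^sup>2 \<le> 1"
    using assms by (metis abs_square_le_1 abs_norm_cancel cmod_power2)
  then have "0 \<le> (1 - Re z) * (1 + Re z) + - Im z * Im z"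
    by (simp add: algebra_simps power2_eq_square)
  then show ?thesis
    by (simp add: Re_divide add_divide_distrib[symmetric] diff_divide_distrib[symmetric])
qed

text \<open>
  \<open>F\<close> is holomorphic in the open disc and bounded by \<open>1\<close>, so the mean value property holds on all
  circles of radius less than \<open>1\<close>. On the unit circle \<open>F\<close> may have an essential singularity at each of
  the finitely many points \<open>- 1 / c j\<close>; away from them the radial limits exist, and dominated
  convergence carries the mean value to the boundary.
\<close>

lemma circle_mean_exp_cayley:
  fixes c :: "'j \<Rightarrow> complex" and w :: "'j \<Rightarrow> real"
  assumes J: "finite J" and c: "\<And>j. j \<in> J \<Longrightarrow> norm (c j) = 1"
    and w: "\<And>j. j \<in> J \<Longrightarrow> w j \<ge> 0" "sum w J = 1" and t: "t \<ge> 0"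
  defines "F \<equiv> \<lambda>z. exp (- of_real t * (\<Sum>j\<in>J. of_real (w j) * ((1 - c j * z) / (1 + c j * z))))"
  shows "(\<integral>s. indicator {0<..<1::real} s *\<^sub>R F (exp (2 * of_real pi * \<i> * of_real s)) \<partial>lborel) = exp (- t)"
proof -
  define E where "E s = exp (2 * of_real pi * \<i> * of_real s)" for s :: real
  have normE: "norm (E s) = 1" for s
    by (simp add: E_def)
  have F0: "F 0 = exp (- t)"
    using w(2) by (simp add: F_def of_real_sum[symmetric] exp_of_real[symmetric])
  have Fm[measurable]: "F \<in> borel_measurable borel"
    unfolding F_def by measurable
  have Em[measurable]: "E \<in> borel_measurable borel"
    unfolding E_def by measurable
  have bound: "norm (F z) \<le> 1" if "norm z \<le> 1" for z
  proof -
    have "0 \<le> (\<Sum>j\<in>J. w j * Re ((1 - c j * z) / (1 + c j * z)))"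
      by (intro sum_nonneg mult_nonneg_nonneg w cayley_Re_nonneg) (use c that in \<open>auto simp: norm_mult\<close>)
    moreover have Re_scale: "Re (of_real a * u) = a * Re u" for a and u :: complex
      by simp
    have "Re (- of_real t * (\<Sum>j\<in>J. of_real (w j) * ((1 - c j * z) / (1 + c j * z))))
       = - t * (\<Sum>j\<in>J. w j * Re ((1 - c j * z) / (1 + c j * z)))"
      by (simp only: minus_mult_left[symmetric] uminus_complex.sel Re_scale Re_sum)
    ultimately have "Re (- of_real t * (\<Sum>j\<in>J. of_real (w j) * ((1 - c j * z) / (1 + c j * z)))) \<le> 0"
      using t by (simp only: mult_minus_left neg_le_0_iff_le mult_nonneg_nonneg)
    then show ?thesis
      by (simp only: F_def norm_exp_eq_Re exp_le_one_iff)
  qed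
  have nz: "1 + c j * z \<noteq> 0" if "j \<in> J" "norm z < 1" for j z
  proof
    assume "1 + c j * z = 0"
    then have "norm (c j * z) = norm (- 1 :: complex)" by (metis add_eq_0_iff minus_minus)
    then show False using c[OF that(1)] that(2) by (simp add: norm_mult)
  qed
  define r where "r n = 1 - 1 / real (n + 2)" for n
  have r: "0 < r n" "r n < 1" for n by (auto simp: r_def field_simps)
  have r_lim: "r \<longlonglongrightarrow> 1"
    unfolding r_def by real_asymp
  have mean: "(\<integral>s. indicator {0<..<1} s *\<^sub>R F (r n * E s) \<partial>lborel) = F 0" for n
  proof -
    have "1 + c j * z \<noteq> 0" if "j \<in> J" "z \<in> cball 0 (r n)" for j z
      using nz[OF that(1), of z] that(2) r[of n] by auto
    then have hol: "F holomorphic_on cball 0 (r n)"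
      unfolding F_def by (intro holomorphic_intros) auto
    have hi: "((\<lambda>s. F (r n * E s)) has_integral F 0) {0..1}"
      unfolding E_def by (rule circle_mean_value) (use hol r in auto)
    have cont: "continuous_on {0..1} (\<lambda>s. F (r n * E s))"
      unfolding E_def
      by (rule continuous_on_compose2[OF holomorphic_on_imp_continuous_on[OF hol]])
         (use r[of n] in \<open>auto intro!: continuous_intros simp: norm_mult\<close>)
    have si: "set_integrable lborel {0..1} (\<lambda>s. F (r n * E s))"
      by (rule borel_integrable_compact[OF _ cont, folded set_integrable_def]) simp
    have "(LINT s:{0..1}|lborel. F (r n * E s)) = F 0"
      using set_borel_integral_eq_integral(2)[OF si] hi by (simp add: integral_unique)
    moreover have "(LINT s:{0..1}|lborel. F (r n * E s)) = (LINT s:{0<..<1}|lborel. F (r n * E s))"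
      unfolding set_lebesgue_integral_def
    proof (rule integral_cong_AE)
      show "AE s in lborel. indicator {0..1} s *\<^sub>R F (r n * E s) = indicator {0<..<1} s *\<^sub>R F (r n * E s)"
        using AE_lborel_singleton[of "0::real"] AE_lborel_singleton[of "1::real"]
        by eventually_elim (auto simp: indicator_def)
    qed measurable
    ultimately show ?thesis by (simp add: set_lebesgue_integral_def)
  qed
  have lim: "(\<lambda>n. F (r n * E s)) \<longlonglongrightarrow> F (E s)" if "\<And>j. j \<in> J \<Longrightarrow> 1 + c j * E s \<noteq> 0" for s
    unfolding F_def using that 
    by (intro tendsto_intros tendsto_eq_intros) (auto intro!: tendsto_eq_intros r_lim)
  (* Each pole is hit for at most one parameter of the circle. *)
  have ae: "AE s in lborel. s \<in> {0<..<1} \<longrightarrow> (\<forall>j\<in>J. 1 + c j * E s \<noteq> 0)"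
  proof -
    have "AE s in lborel. s \<in> {0<..<1} \<longrightarrow> 1 + c j * E s \<noteq> 0" if "j \<in> J" for j
    proof -
      have uniq: "s = s'" if "s \<in> {0<..<1}" "s' \<in> {0<..<1}" "1 + c j * E s = 0" "1 + c j * E s' = 0" for s s'
      proof -
        have "c j \<noteq> 0" using c[OF \<open>j \<in> J\<close>] by auto
        then have "E s = E s'" using that(3,4) by (metis add_left_cancel mult_left_cancel)
        then obtain n :: int where "2 * of_real pi * \<i> * of_real s = 2 * of_real pi * \<i> * of_real s' + (of_int (2 * n) * pi) * \<i>"
          unfolding E_def by (auto simp: exp_eq)
        then have "(2 * of_real pi * \<i>) * (of_real s :: complex) = (2 * of_real pi * \<i>) * of_real (s' + of_int n)"
          by (simp add: algebra_simps)
        then have "s = s' + of_int n" by (simp del: of_real_add)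
        moreover have "n = 0" using that(1,2) \<open>s = s' + of_int n\<close> by auto
        ultimately show ?thesis by simp
      qed
      show ?thesis
      proof (cases "\<exists>s0\<in>{0<..<1}. 1 + c j * E s0 = 0")
        case True
        then obtain s0 where s0: "s0 \<in> {0<..<1}" "1 + c j * E s0 = 0" by blast
        show ?thesis
          by (rule AE_mp[OF AE_lborel_singleton[of s0]]) (use uniq s0 in auto)
      qed auto
    qed
    then have "\<forall>j\<in>J. AE s in lborel. s \<in> {0<..<1} \<longrightarrow> 1 + c j * E s \<noteq> 0" by blast
    then have "AE s in lborel. \<forall>j\<in>J. s \<in> {0<..<1} \<longrightarrow> 1 + c j * E s \<noteq> 0"
      by (subst AE_finite_all[OF J])
    then show ?thesis by eventually_elim auto
  qed
  have "(\<lambda>n. \<integral>s. indicator {0<..<1} s *\<^sub>R F (r n * E s) \<partial>lborel) \<longlonglongrightarrow> (\<integral>s. indicator {0<..<1} s *\<^sub>R F (E s) \<partial>lborel)"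
  proof (rule integral_dominated_convergence[where w="\<lambda>s. indicator {0<..<1} s :: real"])
    show "AE s in lborel. (\<lambda>n. indicator {0<..<1} s *\<^sub>R F (r n * E s)) \<longlonglongrightarrow> indicator {0<..<1} s *\<^sub>R F (E s)"
      using ae by eventually_elim (auto simp: indicator_def intro!: lim)
    show "AE s in lborel. norm (indicator {0<..<1} s *\<^sub>R F (r n * E s)) \<le> indicator {0<..<1} s" for n
    proof (rule AE_I2)
      fix s :: real
      have "norm (F (r n * E s)) \<le> 1"
        by (rule bound) (use r[of n] in \<open>simp add: norm_mult normE\<close>)
      then show "norm (indicator {0<..<1} s *\<^sub>R F (r n * E s)) \<le> indicator {0<..<1} s"
        by (auto simp: indicator_def)
    qed
  qed auto
  then have "(\<integral>s. indicator {0<..<1} s *\<^sub>R F (E s) \<partial>lborel) = F 0"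
    unfolding mean by (simp add: LIMSEQ_const_iff)
  then show ?thesis
    by (simp add: F0 E_def)
qed

section \<open>The Laplace transform for fixed weights\<close>

lemma integral_iexp_linear_gauss:
  assumes K: "finite K"
  shows "(\<integral>z. iexp (\<Sum>k\<in>K. b k * z k) \<partial>gauss K) = exp (- (\<Sum>k\<in>K. (b k)\<^sup>2) / 2)"
proof -
  have int: "integrable std_normal (\<lambda>x. iexp (b k * x))" for k
    by (rule std.integrable_const_bound[where B=1]) (auto simp: norm_exp_i_times)
  have "(\<integral>z. iexp (\<Sum>k\<in>K. b k * z k) \<partial>gauss K) = (\<integral>z. (\<Prod>k\<in>K. iexp (b k * z k)) \<partial>gauss K)"
    by (simp add: sum_distrib_left exp_sum K)
  also have "\<dots> = (\<Prod>k\<in>K. \<integral>x. iexp (b k * x) \<partial>std_normal)"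
    by (rule prod_std.product_integral_prod[OF K int])
  also have "\<dots> = (\<Prod>k\<in>K. char std_normal (b k))"
    by (simp add: char_def)
  also have "\<dots> = (\<Prod>k\<in>K. exp (- complex_of_real ((b k)\<^sup>2 / 2)))"
    by (simp add: char_std_normal_distribution exp_of_real[symmetric])
  also have "\<dots> = exp (\<Sum>k\<in>K. - complex_of_real ((b k)\<^sup>2 / 2))"
    by (rule exp_sum[OF K, symmetric])
  also have "\<dots> = exp (- (\<Sum>k\<in>K. (b k)\<^sup>2) / 2)"
    by (simp add: exp_of_real[symmetric] sum_negf sum_divide_distrib)
  finally show ?thesis .
qed

text \<open>
  Divided by the norm of \<open>a\<close>, the linear form is standard normal, since it has the right
  characteristic function; in particular its law has no atom at \<open>0\<close>.
\<close>

lemma AE_gauss_linear_nonzero: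
  assumes K: "finite K" and a: "k0 \<in> K" "a k0 \<noteq> 0"
  shows "AE z in gauss K. (\<Sum>k\<in>K. a k * z k) \<noteq> 0"
proof -
  interpret G: prob_space "gauss K" by (rule prob_space_gauss)
  define s where "s = sqrt (\<Sum>k\<in>K. (a k)\<^sup>2)"
  have "0 < (\<Sum>k\<in>K. (a k)\<^sup>2)"
    using a K by (intro sum_pos2[of K k0]) auto
  then have s: "0 < s" "s\<^sup>2 = (\<Sum>k\<in>K. (a k)\<^sup>2)" by (auto simp: s_def)
  define Y where "Y z = (\<Sum>k\<in>K. a k / s * z k)" for z
  have Y[measurable]: "Y \<in> borel_measurable (gauss K)" unfolding Y_def by measurable
  have "char (distr (gauss K) borel Y) t = char std_normal t" for t
  proof -
    have "char (distr (gauss K) borel Y) t = (\<integral>z. iexp (t * Y z) \<partial>gauss K)"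
      unfolding char_def by (rule integral_distr) measurable
    also have "\<dots> = (\<integral>z. iexp (\<Sum>k\<in>K. (t * a k / s) * z k) \<partial>gauss K)"
      by (simp add: Y_def sum_distrib_left mult.assoc)
    also have "\<dots> = exp (- (\<Sum>k\<in>K. (t * a k / s)\<^sup>2) / 2)"
      by (rule integral_iexp_linear_gauss[OF K])
    also have "(\<Sum>k\<in>K. (t * a k / s)\<^sup>2) = t\<^sup>2"
    proof -
      have "(\<Sum>k\<in>K. (t * a k / s)\<^sup>2) = t\<^sup>2 / s\<^sup>2 * (\<Sum>k\<in>K. (a k)\<^sup>2)"
        by (simp add: power_mult_distrib power_divide sum_distrib_left)
      then show ?thesis unfolding s(2)[symmetric] using s(1) by simp
    qed
    finally show ?thesis by (simp add: char_std_normal_distribution)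
  qed
  then have "distr (gauss K) borel Y = std_normal"
    by (intro Levy_uniqueness real_dist_normal_dist G.real_distribution_distr Y ext)
  moreover have "AE x in std_normal. x \<noteq> 0"
    by (simp add: AE_density) (use AE_lborel_singleton[of "0::real"] in eventually_elim, simp)
  ultimately have "AE x in distr (gauss K) borel Y. x \<noteq> 0" by (simp only:)
  then have "AE z in gauss K. Y z \<noteq> 0"
    by (subst (asm) AE_distr_iff) auto
  then show ?thesis
  proof eventually_elim
    case (elim z)
    have "Y z = (\<Sum>k\<in>K. a k * z k) / s" by (simp add: Y_def sum_divide_distrib)
    then show ?case using elim by auto
  qed
qed

text \<open>
  Both sides are \<open>- i tan (arg v)\<close>. This links the ratio of the two Gaussian coordinates to the Cayley
  transform of a point on the unit circle. If \<open>Re v = 0\<close> then both sides are divisions by zero.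
\<close>

lemma cayley_eq_slope:
  assumes "v \<noteq> 0"
  shows "(1 - v / cnj v) / (1 + v / cnj v) = - \<i> * of_real (Im v / Re v)"
proof -
  have "(1 - v / cnj v) / (1 + v / cnj v) = ((cnj v - v) / cnj v) / ((cnj v + v) / cnj v)"
    using assms by (simp add: diff_divide_distrib add_divide_distrib)
  also have "\<dots> = (cnj v - v) / (cnj v + v)"
    using assms by simp
  also have "cnj v - v = - 2 * \<i> * of_real (Im v)" by (simp add: complex_eq_iff)
  also have "cnj v + v = 2 * of_real (Re v)" by (simp add: complex_eq_iff)
  finally show ?thesis by simp
qed

text \<open>
  The integral of \<open>h\<close> over an independent Gaussian pair is computed twice. Integrating out the second
  vector gives the left-hand side, by the Gaussian characteristic function. Averaging over
  rotations of the pair instead gives \<open>exp (- t)\<close> at almost every pair, by the mean value property on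
  the disc. Arbitrary finite index sets cover both a vector indexed by a finite type and the single
  coordinate, indexed by \<open>{..<1}\<close>, in the definition of the chi-squared law.
\<close>

lemma integral_gauss_exp_inverse_form:
  fixes a :: "'j \<Rightarrow> 'k \<Rightarrow> real" and w :: "'j \<Rightarrow> real"
  assumes K: "finite K" and J: "finite J" and a: "\<And>j. j \<in> J \<Longrightarrow> \<exists>k\<in>K. a j k \<noteq> 0"
    and w: "\<And>j. j \<in> J \<Longrightarrow> w j \<ge> 0" "sum w J = 1" and t: "t \<ge> 0"
  shows "(\<integral>z. exp (- (t\<^sup>2 / 2) * (\<Sum>k\<in>K. (\<Sum>j\<in>J. w j * a j k / (\<Sum>l\<in>K. a j l * z l))\<^sup>2)) \<partial>gauss K) = exp (- t)"
proof -
  let ?G = "gauss K"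
  define x where "x j z = (\<Sum>l\<in>K. a j l * z l)" for j and z :: "'k \<Rightarrow> real"
  have [measurable]: "x j \<in> borel_measurable ?G" for j
    unfolding x_def by measurable
  (* The angle of rotation is pi * s with s uniform on (0, 1), so that
     exp (2 * pi * i * s), the square of the unit vector in that direction, runs once
     around the circle while the half turn s = 1 is avoided. *)
  define U where "U = density lborel (\<lambda>s. ennreal (indicator {0<..<1::real} s))"
  have [measurable_cong]: "sets U = sets borel" by (simp add: U_def)
  interpret G: prob_space ?G by (rule prob_space_gauss)
  interpret U: prob_space U
    by (rule prob_spaceI) (simp add: U_def emeasure_density ennreal_indicator)
  interpret GG: pair_prob_space ?G ?G ..
  interpret GGU: pair_prob_space "?G \<Otimes>\<^sub>M ?G" U ..
  define h where "h p = iexp (t * (\<Sum>j\<in>J. w j * (x j (snd p) / x j (fst p))))" for p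
  have h[measurable]: "h \<in> borel_measurable (?G \<Otimes>\<^sub>M ?G)"
    unfolding h_def by measurable
  have norm_h: "norm (h p) = 1" for p
    by (simp add: h_def norm_exp_i_times)
  have rot[measurable]: "(\<lambda>(p, s). rotate_pair K (pi * s) p) \<in> (?G \<Otimes>\<^sub>M ?G) \<Otimes>\<^sub>M U \<rightarrow>\<^sub>M ?G \<Otimes>\<^sub>M ?G"
    unfolding rotate_pair_def by measurable

  have "(\<integral>p. h p \<partial>(?G \<Otimes>\<^sub>M ?G)) = (\<integral>z. \<integral>z'. h (z, z') \<partial>?G \<partial>?G)"
    by (rule GG.integral_fst'[symmetric], rule GG.integrable_const_bound[where B=1]) (auto simp: norm_h)
  also have "\<dots> = (\<integral>z. complex_of_real (exp (- (t\<^sup>2 / 2) * (\<Sum>k\<in>K. (\<Sum>j\<in>J. w j * a j k / x j z)\<^sup>2))) \<partial>?G)"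
  proof (rule Bochner_Integration.integral_cong[OF refl])
    fix z
    define b where "b k = t * (\<Sum>j\<in>J. w j * a j k / x j z)" for k
    have "t * (\<Sum>j\<in>J. w j * (x j z' / x j z)) = (\<Sum>k\<in>K. b k * z' k)" for z'
    proof -
      have "w j * (x j z' / x j z) = (\<Sum>k\<in>K. w j * a j k / x j z * z' k)" for j
      proof -
        have "w j * (x j z' / x j z) = (w j / x j z) * (\<Sum>k\<in>K. a j k * z' k)"
          by (simp add: x_def)
        also have "\<dots> = (\<Sum>k\<in>K. w j * a j k / x j z * z' k)"
          by (subst sum_distrib_left) (simp add: mult_ac)
        finally show ?thesis .
      qed
      then have "t * (\<Sum>j\<in>J. w j * (x j z' / x j z)) = t * (\<Sum>j\<in>J. \<Sum>k\<in>K. w j * a j k / x j z * z' k)"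
        by (simp only:)
      also have "\<dots> = t * (\<Sum>k\<in>K. \<Sum>j\<in>J. w j * a j k / x j z * z' k)"
        by (simp only: sum.swap[of _ J K])
      also have "\<dots> = (\<Sum>k\<in>K. b k * z' k)"
        unfolding b_def sum_distrib_left sum_distrib_right mult.assoc ..
      finally show ?thesis .
    qed
    then have "(\<integral>z'. h (z, z') \<partial>?G) = (\<integral>z'. iexp (\<Sum>k\<in>K. b k * z' k) \<partial>?G)"
      unfolding h_def by simp
    also have "\<dots> = exp (- (\<Sum>k\<in>K. (b k)\<^sup>2) / 2)"
      by (rule integral_iexp_linear_gauss[OF K])
    also have "- (\<Sum>k\<in>K. (b k)\<^sup>2) / 2 = - (t\<^sup>2 / 2) * (\<Sum>k\<in>K. (\<Sum>j\<in>J. w j * a j k / x j z)\<^sup>2)"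
      by (simp add: b_def power_mult_distrib sum_distrib_left[symmetric])
    finally show "(\<integral>z'. h (z, z') \<partial>?G) = complex_of_real (exp (- (t\<^sup>2 / 2) * (\<Sum>k\<in>K. (\<Sum>j\<in>J. w j * a j k / x j z)\<^sup>2)))"
      by simp
  qed
  finally have 1: "(\<integral>p. h p \<partial>(?G \<Otimes>\<^sub>M ?G))
    = complex_of_real (\<integral>z. exp (- (t\<^sup>2 / 2) * (\<Sum>k\<in>K. (\<Sum>j\<in>J. w j * a j k / x j z)\<^sup>2)) \<partial>?G)"
    by simp

  have "(\<integral>p. h p \<partial>(?G \<Otimes>\<^sub>M ?G)) = (\<integral>s. (\<integral>p. h p \<partial>(?G \<Otimes>\<^sub>M ?G)) \<partial>U)"
    by (simp add: U.prob_space)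
  also have "\<dots> = (\<integral>s. (\<integral>p. h (rotate_pair K (pi * s) p) \<partial>(?G \<Otimes>\<^sub>M ?G)) \<partial>U)"
  proof (rule integral_cong_AE)
    show "AE s in U. (\<integral>p. h p \<partial>(?G \<Otimes>\<^sub>M ?G)) = (\<integral>p. h (rotate_pair K (pi * s) p) \<partial>(?G \<Otimes>\<^sub>M ?G))"
      unfolding U_def
    proof (subst AE_density, simp, intro AE_I2 impI)
      fix s :: real assume "0 < ennreal (indicator {0<..<1} s)"
      then have s: "0 < s" "s < 1" by (auto simp: indicator_def split: if_splits)
      have "cos (pi * s) > cos pi"
        using s by (intro cos_monotone_0_pi) auto
      then have "cos (pi * s) \<noteq> -1" by simp
      note inv = gauss_rotation_invariant[OF K this]
      have "(\<integral>p. h p \<partial>(?G \<Otimes>\<^sub>M ?G)) = (\<integral>p. h p \<partial>distr (?G \<Otimes>\<^sub>M ?G) (?G \<Otimes>\<^sub>M ?G) (rotate_pair K (pi * s)))"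
        by (simp only: inv)
      also have "\<dots> = (\<integral>p. h (rotate_pair K (pi * s) p) \<partial>(?G \<Otimes>\<^sub>M ?G))"
        by (rule integral_distr) measurable
      finally show "(\<integral>p. h p \<partial>(?G \<Otimes>\<^sub>M ?G)) = (\<integral>p. h (rotate_pair K (pi * s) p) \<partial>(?G \<Otimes>\<^sub>M ?G))" .
    qed
  qed measurable
  also have "\<dots> = (\<integral>p. (\<integral>s. h (rotate_pair K (pi * s) p) \<partial>U) \<partial>(?G \<Otimes>\<^sub>M ?G))"
    by (rule GGU.Fubini_integral, rule GGU.integrable_const_bound[where B=1]) (auto simp: norm_h)
  also have "\<dots> = (\<integral>p. complex_of_real (exp (- t)) \<partial>(?G \<Otimes>\<^sub>M ?G))"
  proof (rule integral_cong_AE)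
    have "\<forall>j\<in>J. AE z in ?G. x j z \<noteq> 0"
      unfolding x_def using a AE_gauss_linear_nonzero[OF K] by blast
    then have "AE z in ?G. \<forall>j\<in>J. x j z \<noteq> 0"
      by (subst AE_finite_all[OF J])
    then have "AE z in distr (?G \<Otimes>\<^sub>M ?G) ?G fst. \<forall>j\<in>J. x j z \<noteq> 0"
      by (simp only: G.distr_pair_fst)
    then have "AE p in ?G \<Otimes>\<^sub>M ?G. \<forall>j\<in>J. x j (fst p) \<noteq> 0"
      using AE_distrD[OF measurable_fst] by blast
    then show "AE p in ?G \<Otimes>\<^sub>M ?G. (\<integral>s. h (rotate_pair K (pi * s) p) \<partial>U) = complex_of_real (exp (- t))"
    proof eventually_elim
      case (elim p)
      (* The rotation multiplies every u j by the same unit complex number. *)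
      define u where "u j = Complex (x j (fst p)) (x j (snd p))" for j
      have u: "u j \<noteq> 0" if "j \<in> J" for j
        using elim that by (auto simp: u_def complex_eq_iff)
      define c where "c j = u j / cnj (u j)" for j
      have c: "norm (c j) = 1" if "j \<in> J" for j
        using u[OF that] by (simp add: c_def norm_divide)
      have "h (rotate_pair K (pi * s) p) = exp (- of_real t * (\<Sum>j\<in>J. of_real (w j) *
            ((1 - c j * exp (2 * of_real pi * \<i> * of_real s)) / (1 + c j * exp (2 * of_real pi * \<i> * of_real s)))))" for s
      proof -
        define v where "v j = u j * cis (pi * s)" for j
        have "x j (fst (rotate_pair K (pi * s) p)) = cos (pi * s) * x j (fst p) - sin (pi * s) * x j (snd p)" for j
          by (simp add: x_def rotate_pair_def right_diff_distrib sum_subtractf sum_distrib_left mult.left_commute cong: sum.cong)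
        then have Re: "x j (fst (rotate_pair K (pi * s) p)) = Re (v j)" for j
          by (simp add: v_def u_def)
        have "x j (snd (rotate_pair K (pi * s) p)) = sin (pi * s) * x j (fst p) + cos (pi * s) * x j (snd p)" for j
          by (simp add: x_def rotate_pair_def distrib_left sum.distrib sum_distrib_left mult.left_commute cong: sum.cong)
        then have Im: "x j (snd (rotate_pair K (pi * s) p)) = Im (v j)" for j
          by (simp add: v_def u_def)
        have "c j * exp (2 * of_real pi * \<i> * of_real s) = v j / cnj (v j)" for j
        proof -
          have "exp (2 * of_real pi * \<i> * of_real s) = cis (pi * s) * cis (pi * s)"
            by (simp add: cis_conv_exp mult_exp_exp mult_ac)
          moreover have "inverse (cnj (cis (pi * s))) = cis (pi * s)"
            by (simp add: cis_cnj)
          ultimately show ?thesis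
            unfolding c_def v_def divide_inverse complex_cnj_mult inverse_mult_distrib by (simp only: mult_ac)
        qed
        moreover have "v j \<noteq> 0" if "j \<in> J" for j
          using u[OF that] by (simp add: v_def)
        ultimately have cay: "(1 - c j * exp (2 * of_real pi * \<i> * of_real s)) / (1 + c j * exp (2 * of_real pi * \<i> * of_real s))
            = - \<i> * of_real (Im (v j) / Re (v j))" if "j \<in> J" for j
          using that cayley_eq_slope by metis
        have "(\<Sum>j\<in>J. of_real (w j) * ((1 - c j * exp (2 * of_real pi * \<i> * of_real s)) / (1 + c j * exp (2 * of_real pi * \<i> * of_real s))))
            = (\<Sum>j\<in>J. - \<i> * of_real (w j * (Im (v j) / Re (v j))))"
          by (rule sum.cong[OF refl]) (simp add: cay)
        also have "\<dots> = - \<i> * of_real (\<Sum>j\<in>J. w j * (Im (v j) / Re (v j)))"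
          by (simp only: sum_distrib_left of_real_sum)
        finally show ?thesis
          by (simp add: h_def Re Im mult.left_commute)
      qed
      then have "(\<integral>s. h (rotate_pair K (pi * s) p) \<partial>U) = (\<integral>s. exp (- of_real t * (\<Sum>j\<in>J. of_real (w j) *
            ((1 - c j * exp (2 * of_real pi * \<i> * of_real s)) / (1 + c j * exp (2 * of_real pi * \<i> * of_real s))))) \<partial>U)"
        by simp
      also have "\<dots> = (\<integral>s. indicator {0<..<1} s *\<^sub>R exp (- of_real t * (\<Sum>j\<in>J. of_real (w j) *
            ((1 - c j * exp (2 * of_real pi * \<i> * of_real s)) / (1 + c j * exp (2 * of_real pi * \<i> * of_real s))))) \<partial>lborel)"
        unfolding U_def by (rule integral_density) auto
      also have "\<dots> = exp (- t)"
        by (rule circle_mean_exp_cayley[OF J c w t])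
      finally show ?case .
    qed
  qed measurable
  also have "\<dots> = complex_of_real (exp (- t))"
    by (simp add: GG.prob_space)
  finally show ?thesis
    unfolding 1 of_real_eq_iff x_def .
qed

section \<open>Laws on the half-line and their Laplace transforms\<close>

text \<open>
  The exponential series is integrated term by term, which is permitted because \<open>exp (- x)\<close> is
  almost surely bounded by \<open>1\<close>; its moments are values of the Laplace transform.
\<close>

lemma char_distr_exp_uminus:
  fixes N :: "real measure"
  assumes N: "prob_space N" "sets N = sets borel" and pos: "AE x in N. 0 \<le> x"
  shows "char (distr N borel (\<lambda>x. exp (- x))) u
       = (\<Sum>n. (\<i> * u) ^ n / fact n * complex_of_real (\<integral>x. exp (- (real n * x)) \<partial>N))"
proof -
  interpret N: prob_space N by fact
  have [measurable_cong]: "sets N = sets borel" by fact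
  define f where "f n x = (\<i> * of_real u) ^ n / fact n * complex_of_real (exp (- (real n * x)))" for n x
  have [measurable]: "f n \<in> borel_measurable N" for n
    unfolding f_def by measurable
  have norm_f: "norm (f n x) \<le> \<bar>u\<bar> ^ n / fact n" if "0 \<le> x" for n x
  proof -
    have "norm (f n x) = \<bar>u\<bar> ^ n / fact n * exp (- (real n * x))"
      by (simp add: f_def norm_mult norm_divide norm_power)
    also have "\<dots> \<le> \<bar>u\<bar> ^ n / fact n * 1"
      using that by (intro mult_left_mono) auto
    finally show ?thesis by simp
  qed
  have summ: "summable (\<lambda>n. \<bar>u\<bar> ^ n / fact n)"
    using summable_exp[of "\<bar>u\<bar>"] by (simp add: field_simps)
  have int: "integrable N (f n)" for n
    by (rule N.integrable_const_bound[where B="\<bar>u\<bar> ^ n / fact n"]) (use pos norm_f in \<open>auto elim: eventually_mono\<close>)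
  have "char (distr N borel (\<lambda>x. exp (- x))) u = (\<integral>x. iexp (u * exp (- x)) \<partial>N)"
    unfolding char_def by (rule integral_distr) measurable
  also have "\<dots> = (\<integral>x. (\<Sum>n. f n x) \<partial>N)"
  proof (rule Bochner_Integration.integral_cong[OF refl])
    fix x
    have "f n x = (\<i> * of_real (u * exp (- x))) ^ n /\<^sub>R fact n" for n
      by (simp add: f_def power_mult_distrib scaleR_conv_of_real exp_of_nat_mult[symmetric] divide_inverse flip: of_real_power)
    then show "iexp (u * exp (- x)) = (\<Sum>n. f n x)"
      by (simp add: exp_def)
  qed
  also have "\<dots> = (\<Sum>n. \<integral>x. f n x \<partial>N)"
  proof (rule integral_suminf[OF int])
    show "AE x in N. summable (\<lambda>n. norm (f n x))"
      using pos by eventually_elim (rule summable_comparison_test'[OF summ, of 0], simp add: norm_f)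
    have "(\<integral>x. norm (f n x) \<partial>N) \<le> \<bar>u\<bar> ^ n / fact n" for n
    proof -
      have "(\<integral>x. norm (f n x) \<partial>N) \<le> (\<integral>x. \<bar>u\<bar> ^ n / fact n \<partial>N)"
        by (rule integral_mono_AE) (use int pos norm_f in \<open>auto elim: eventually_mono\<close>)
      then show ?thesis by (simp add: N.prob_space)
    qed
    then show "summable (\<lambda>n. \<integral>x. norm (f n x) \<partial>N)"
      by (intro summable_comparison_test'[OF summ, of 0]) simp
  qed
  also have "\<dots> = (\<Sum>n. (\<i> * u) ^ n / fact n * complex_of_real (\<integral>x. exp (- (real n * x)) \<partial>N))"
    unfolding f_def by simp
  finally show ?thesis .
qed

text \<open>
  Only the transform at natural numbers is needed: by the preceding series these values determine the
  characteristic function of \<open>exp (- x)\<close>, hence by Levy's theorem its law, and the logarithm recovers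
  the law of \<open>x\<close> itself.
\<close>

lemma distr_eqI_laplace:
  fixes N1 N2 :: "real measure"
  assumes N1: "prob_space N1" "sets N1 = sets borel" "AE x in N1. 0 \<le> x"
    and N2: "prob_space N2" "sets N2 = sets borel" "AE x in N2. 0 \<le> x"
    and eq: "\<And>n::nat. (\<integral>x. exp (- (real n * x)) \<partial>N1) = (\<integral>x. exp (- (real n * x)) \<partial>N2)"
  shows "N1 = N2"
proof -
  let ?e = "\<lambda>x::real. exp (- x)"
  have real_dist: "real_distribution (distr N borel ?e)" if "prob_space N" "sets N = sets borel" for N
  proof -
    have [measurable_cong]: "sets N = sets borel" by fact
    show ?thesis by (rule prob_space.real_distribution_distr[OF that(1)]) measurable
  qed
  have undo: "distr (distr N borel ?e) borel (\<lambda>y. - ln y) = N" if "sets N = sets borel" for N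
  proof -
    have [measurable_cong]: "sets N = sets borel" by fact
    have "distr (distr N borel ?e) borel (\<lambda>y. - ln y) = distr N borel (\<lambda>x. x)"
      by (subst distr_distr) (auto simp: comp_def)
    also have "\<dots> = N"
      using that by (rule distr_id2[OF sym])
    finally show ?thesis .
  qed
  have "distr N1 borel ?e = distr N2 borel ?e"
  proof (rule Levy_uniqueness[OF real_dist[OF N1(1,2)] real_dist[OF N2(1,2)]], rule ext)
    show "char (distr N1 borel ?e) u = char (distr N2 borel ?e) u" for u
      unfolding char_distr_exp_uminus[OF N1] char_distr_exp_uminus[OF N2] eq ..
  qed
  then have "distr (distr N1 borel ?e) borel (\<lambda>y. - ln y) = distr (distr N2 borel ?e) borel (\<lambda>y. - ln y)"
    by (rule arg_cong)
  then show ?thesis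
    unfolding undo[OF N1(2)] undo[OF N2(2)] .
qed

section \<open>The distribution of the quadratic form\<close>

text \<open>
  The variable \<open>1 / Z\<^sup>2\<close> is the quadratic form in dimension one, so its transform needs no separate
  computation.
\<close>

lemma inverse_chi_squared_1_laplace:
  fixes s :: real
  assumes "0 \<le> s"
  shows "(\<integral>x. exp (- (s * x)) \<partial>inverse_chi_squared 1) = exp (- sqrt (2 * s))"
proof -
  let ?P = "gauss {..<1::nat}"
  have [measurable]: "(\<lambda>z. \<Sum>i<1. (z i)\<^sup>2) \<in> borel_measurable ?P" by measurable
  have "(\<integral>x. exp (- (s * x)) \<partial>inverse_chi_squared 1) = (\<integral>x. exp (- (s * inverse x)) \<partial>chi_squared 1)"
    unfolding inverse_chi_squared_def by (rule integral_distr) (auto simp: chi_squared_def)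
  also have "\<dots> = (\<integral>z. exp (- (s * inverse (\<Sum>i<1::nat. (z i)\<^sup>2))) \<partial>?P)"
    unfolding chi_squared_def by (rule integral_distr) auto
  also have "\<dots> = (\<integral>z. exp (- ((sqrt (2 * s))\<^sup>2 / 2) * (\<Sum>k<1::nat. (\<Sum>j\<in>{()}. 1 * 1 / (\<Sum>l<1. 1 * z l))\<^sup>2)) \<partial>?P)"
  proof (rule Bochner_Integration.integral_cong[OF refl])
    fix z :: "nat \<Rightarrow> real"
    have "(\<Sum>k<1::nat. (\<Sum>j\<in>{()}. 1 * 1 / (\<Sum>l<1. 1 * z l))\<^sup>2) = inverse (\<Sum>i<1. (z i)\<^sup>2)"
      by (simp add: inverse_eq_divide power_divide)
    moreover have "(sqrt (2 * s))\<^sup>2 / 2 = s" using assms by simp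
    ultimately show "exp (- (s * inverse (\<Sum>i<1. (z i)\<^sup>2)))
        = exp (- ((sqrt (2 * s))\<^sup>2 / 2) * (\<Sum>k<1::nat. (\<Sum>j\<in>{()}. 1 * 1 / (\<Sum>l<1. 1 * z l))\<^sup>2))"
      by (simp only: mult_minus_left)
  qed
  also have "\<dots> = exp (- sqrt (2 * s))"
    using assms by (intro integral_gauss_exp_inverse_form[where a="\<lambda>_ _. 1" and w="\<lambda>_. 1"]) auto
  finally show ?thesis .
qed

lemma inverse_chi_squared_properties:
  "prob_space (inverse_chi_squared k)" "sets (inverse_chi_squared k) = sets borel"
  "AE x in inverse_chi_squared k. 0 \<le> x"
proof -
  have inv[measurable]: "inverse \<in> chi_squared k \<rightarrow>\<^sub>M borel"
    by (simp add: chi_squared_def)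
  have [measurable]: "(\<lambda>z. \<Sum>i<k. (z i)\<^sup>2) \<in> borel_measurable (gauss {..<k})" by measurable
  show "prob_space (inverse_chi_squared k)" "sets (inverse_chi_squared k) = sets borel"
    unfolding inverse_chi_squared_def
    by (auto intro: prob_space.prob_space_distr prob_space_chi_squared)
  have "AE x in chi_squared k. 0 \<le> inverse x"
    unfolding chi_squared_def by (subst AE_distr_iff) (auto intro!: AE_I2 sum_nonneg)
  then show "AE x in inverse_chi_squared k. 0 \<le> x"
    unfolding inverse_chi_squared_def by (subst AE_distr_iff) auto
qed

lemma gram_form:
  fixes A :: "real^'k^'n"
  shows "(y v* (A ** transpose A)) \<bullet> y = (\<Sum>k\<in>UNIV. (\<Sum>j\<in>UNIV. y $ j * A $ j $ k)\<^sup>2)"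
proof -
  have "(y v* (A ** transpose A)) \<bullet> y = y \<bullet> (A *v (transpose A *v y))"
    by (simp add: dot_lmul_matrix matrix_vector_mul_assoc del: transpose_matrix_vector)
  also have "\<dots> = (y v* A) \<bullet> (y v* A)"
    by (simp add: dot_lmul_matrix[symmetric] transpose_matrix_vector)
  also have "\<dots> = (\<Sum>k\<in>UNIV. (\<Sum>j\<in>UNIV. y $ j * A $ j $ k)\<^sup>2)"
    by (simp add: inner_vec_def vector_matrix_mult_def power2_eq_square mult.commute)
  finally show ?thesis .
qed

text \<open>
  In terms of a factor \<open>A\<close> of \<open>S\<close>, the form is the sum of squares treated above, with \<open>t = sqrt (2 * s)\<close>.
  The rows of \<open>A\<close> do not vanish because their squared norms are the diagonal entries of \<open>S\<close>.
\<close>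

lemma centered_gaussian_laplace:
  fixes S :: "real^'n^'n" and v :: "real^'n"
  assumes S: "\<And>j. S $ j $ j > 0" and N: "centered_gaussian S N"
    and v: "\<And>j. v $ j \<ge> 0" "(\<Sum>j\<in>UNIV. v $ j) = 1" and s: "0 \<le> s"
  defines "q \<equiv> \<lambda>x :: real^'n. let y = (\<chi> j. v $ j / x $ j) in (y v* S) \<bullet> y"
  assumes q: "q \<in> borel_measurable borel"
  shows "(\<integral>x. exp (- (s * q x)) \<partial>N) = exp (- sqrt (2 * s))"
proof -
  obtain A :: "real^'n^'n" where A: "A ** transpose A = S"
    and N: "N = distr (gauss UNIV) borel (\<lambda>z. A *v (\<chi> j. z j))"
    using N unfolding centered_gaussian_def by blast
  have row: "\<exists>k\<in>UNIV. A $ j $ k \<noteq> 0" for j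
  proof (rule ccontr)
    assume "\<not> (\<exists>k\<in>UNIV. A $ j $ k \<noteq> 0)"
    then have "S $ j $ j = 0" by (simp add: A[symmetric] matrix_matrix_mult_def)
    then show False using S[of j] by simp
  qed
  have "(\<integral>x. exp (- (s * q x)) \<partial>N) = (\<integral>z. exp (- (s * q (A *v (\<chi> j. z j)))) \<partial>gauss UNIV)"
    unfolding N using q by (intro integral_distr) measurable
  also have "\<dots> = (\<integral>z. exp (- ((sqrt (2 * s))\<^sup>2 / 2) *
      (\<Sum>k\<in>UNIV. (\<Sum>j\<in>UNIV. v $ j * A $ j $ k / (\<Sum>l\<in>UNIV. A $ j $ l * z l))\<^sup>2)) \<partial>gauss UNIV)"
    using s by (simp add: q_def Let_def A[symmetric] gram_form matrix_vector_mult_def)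
  also have "\<dots> = exp (- sqrt (2 * s))"
    by (rule integral_gauss_exp_inverse_form[OF _ _ row]) (use v s in auto)
  finally show ?thesis .
qed

theorem theorem2p2:
  fixes M :: "'a measure"
    and S :: "real^'n^'n"
    and X w :: "'a \<Rightarrow> real^'n"
  assumes "prob_space M"
    and "psd_matrix S"
    and "\<And>j. S $ j $ j > 0"
    and "X \<in> borel_measurable M"
    and "centered_gaussian S (distr M borel X)"
    and "w \<in> borel_measurable M"
    and "prob_space.indep_var M borel w borel X"
    and "AE \<omega> in M. (\<forall>j. w \<omega> $ j \<ge> 0) \<and> (\<Sum>j\<in>UNIV. w \<omega> $ j) = 1"
  shows "distr M borel
           (\<lambda>\<omega>. let y = (\<chi> j. w \<omega> $ j / X \<omega> $ j) in (y v* S) \<bullet> y)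
         = inverse_chi_squared 1"
proof -
  interpret prob_space M by fact
  note [measurable] = \<open>X \<in> borel_measurable M\<close> \<open>w \<in> borel_measurable M\<close>
  have nth[measurable]: "(\<lambda>x :: real^'n. x $ j) \<in> borel_measurable borel" for j
    by (intro borel_measurable_continuous_onI continuous_intros)
  define q :: "real^'n \<Rightarrow> real^'n \<Rightarrow> real"
    where "q v x = (let y = (\<chi> j. v $ j / x $ j) in (y v* S) \<bullet> y)" for v x
  have q[measurable]: "(\<lambda>p. q (fst p) (snd p)) \<in> borel_measurable (borel \<Otimes>\<^sub>M borel)"
    unfolding q_def Let_def inner_vec_def vector_matrix_mult_def by simp
  have q_snd: "q v \<in> borel_measurable borel" for v
    using measurable_compose[OF measurable_Pair1'[of v borel borel] q] by simp
  define Q where "Q \<omega> = q (w \<omega>) (X \<omega>)" for \<omega>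
  have Q[measurable]: "Q \<in> borel_measurable M"
    using measurable_compose[OF _ q, of "\<lambda>\<omega>. (w \<omega>, X \<omega>)" M] by (simp add: Q_def[abs_def])
  have joint: "distr M borel w \<Otimes>\<^sub>M distr M borel X = distr M (borel \<Otimes>\<^sub>M borel) (\<lambda>\<omega>. (w \<omega>, X \<omega>))"
    using assms(7) indep_var_distribution_eq by blast
  interpret W: prob_space "distr M borel w" by (rule prob_space_distr) simp
  interpret X: prob_space "distr M borel X" by (rule prob_space_distr) simp
  interpret WX: pair_prob_space "distr M borel w" "distr M borel X" ..
  have q_nonneg: "0 \<le> q v x" for v x
    using \<open>psd_matrix S\<close> by (simp add: q_def Let_def psd_matrix_def dot_lmul_matrix)
  have "(\<integral>\<omega>. exp (- (real n * Q \<omega>)) \<partial>M) = exp (- sqrt (2 * real n))" for n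
  proof -
    have "(\<integral>\<omega>. exp (- (real n * Q \<omega>)) \<partial>M)
        = (\<integral>p. exp (- (real n * q (fst p) (snd p))) \<partial>(distr M borel w \<Otimes>\<^sub>M distr M borel X))"
      unfolding joint Q_def by (subst integral_distr) auto
    also have "\<dots> = (\<integral>v. \<integral>x. exp (- (real n * q v x)) \<partial>distr M borel X \<partial>distr M borel w)"
      by (subst WX.integral_fst'[symmetric], rule WX.integrable_const_bound[where B=1])
         (auto simp: q_nonneg)
    (* By independence the weights can be frozen, and the inner integral does not depend on them. *)
    also have "\<dots> = (\<integral>v. exp (- sqrt (2 * real n)) \<partial>distr M borel w)"
    proof (rule integral_cong_AE)
      have "AE v in distr M borel w. (\<forall>j. v $ j \<ge> 0) \<and> (\<Sum>j\<in>UNIV. v $ j) = 1"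
        using assms(8) by (subst AE_distr_iff) auto
      then show "AE v in distr M borel w. (\<integral>x. exp (- (real n * q v x)) \<partial>distr M borel X) = exp (- sqrt (2 * real n))"
      proof eventually_elim
        case (elim v)
        then show ?case
          using centered_gaussian_laplace[OF assms(3,5), of v "real n"] q_snd[of v]
          unfolding q_def by simp
      qed
    qed measurable
    also have "\<dots> = exp (- sqrt (2 * real n))"
      using W.prob_space by simp
    finally show ?thesis .
  qed
  then have "(\<integral>x. exp (- (real n * x)) \<partial>distr M borel Q) = (\<integral>x. exp (- (real n * x)) \<partial>inverse_chi_squared 1)" for n
    by (subst integral_distr) (auto simp: inverse_chi_squared_1_laplace simp del: One_nat_def)
  then have "distr M borel Q = inverse_chi_squared 1"
    by (intro distr_eqI_laplace inverse_chi_squared_properties prob_space_distr)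
       (auto simp: AE_distr_iff Q_def q_nonneg)
  then show ?thesis
    by (simp add: Q_def[abs_def] q_def)
qed

end
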